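(* Let $S\subset\mathbb N_0$ be a numerical monoid. (1) If $H=\mathcal P_{\mathrm{fin},0}(S)$, then \[\lim_{x\to\infty}\frac{\#\{A\in\mathcal A(H)\colon \max(A)\le x\}}{\#\{A\in H\colon \max(A)\le x\}}=1.\] (2) If $H=\mathcal P_{\mathrm{fin}}(S)$, then the limit \[\lim_{x\to\infty}\frac{\#\{A\in\mathcal A(H)\colon \max(A)\le x\}}{\#\{A\in H\colon \max(A)\le x\}}\] exists and lies in $[1/2,1)\cap\mathbb Q$. Moreover, this limit equals $1/2$ if and only if $S=\mathbb N_0$.
   Context: A numerical monoid is an additive submonoid $S\subset\mathbb N_0$ with $\gcd(S)=1$. For an additive submonoid $S\subset\mathbb Z$, $\mathcal P_{\mathrm{fin}}(S)$ (the power monoid) is the set of all finite nonempty subsets of $S$ with set addition $A+B=\{a+b\colon a\in A,b\in B\}$ as operation; its identity is $\{0\}$. $\mathcal P_{\mathrm{fin},0}(S)$ (the restricted power monoid) is the submonoid of $\mathcal P_{\mathrm{fin}}(S)$ consisting of the finite nonempty subsets of $S$ containing $0$. The only invertible element of these monoids is $\{0\}$. For a monoid $H$ of this kind, $\mathcal A(H)$ denotes its set of atoms: elements $A\ne\{0\}$ such that $A=B+C$ with $B,C\in H$ implies $B=\{0\}$ or $C=\{0\}$. *)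

theory Defs
  imports Complex_Main "HOL-Library.Set_Algebras"
begin

definition additive_submonoid :: "'a::comm_monoid_add set \<Rightarrow> bool" where
  "additive_submonoid S \<longleftrightarrow> 0 \<in> S \<and> (\<forall>a\<in>S. \<forall>b\<in>S. a + b \<in> S)"

definition numerical_monoid :: "nat set \<Rightarrow> bool" where
  "numerical_monoid S \<longleftrightarrow> additive_submonoid S \<and> Gcd S = 1"

text \<open>
  The monoids below are represented by their carriers. The operation is the elementwise sum
  \<open>A + B = {a + b | a \<in> A, b \<in> B}\<close> of HOL-Library.Set_Algebras, with identity \<open>{0}\<close>.
\<close>

definition power_monoid :: "'a::comm_monoid_add set \<Rightarrow> 'a set set" where
  "power_monoid S = {A. finite A \<and> A \<noteq> {} \<and> A \<subseteq> S}"

definition restricted_power_monoid :: "'a::comm_monoid_add set \<Rightarrow> 'a set set" where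
  "restricted_power_monoid S = {A \<in> power_monoid S. 0 \<in> A}"

text \<open>
  Atoms of a monoid of sets whose only invertible element is \<open>{0}\<close>.
\<close>

definition atoms :: "'a::comm_monoid_add set set \<Rightarrow> 'a set set" where
  "atoms H = {A \<in> H. A \<noteq> {0} \<and> (\<forall>B\<in>H. \<forall>C\<in>H. A = B + C \<longrightarrow> B = {0} \<or> C = {0})}"

definition atom_density :: "nat set set \<Rightarrow> real \<Rightarrow> real" where
  "atom_density H x =
     real (card {A \<in> atoms H. real (Max A) \<le> x}) / real (card {A \<in> H. real (Max A) \<le> x})"

end

(* Call A decomposable if A = B + C with B and C of size at least 2. Decomposable subsets of [0, n]
   are a vanishing proportion of all subsets. If B has width at most t, then every a in A lies in a
   translate of B contained in A; a random set violates this with probability at least 1/8 in each of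
   about n/(2t+1) disjoint windows. If B and C both have width larger than t, then for all but a
   proportion of about n (3/4)^t of the pairs the sumset contains everything except initial and
   final segments of length t, so these pairs produce at most 4^t sumsets per choice of widths and minima.
   Taking t about n^(1/3) makes both contributions negligible.
   For sets containing 0, all non-atoms other than {0} are decomposable. In the full power monoid the
   remaining non-atoms are, up to singletons, the sets contained in a translate s + S with 0 < s in S.
   This property depends only on the elements up to 3c, where c is such that S contains all n >= c, so
   the proportion of these sets is eventually a constant beta > 0. No such set contains 0, so
   beta <= 1/2, and equality means that all sets without 0 qualify, which forces S to be everything. *)

theory Submission
  imports Defs "HOL-Library.Disjoint_Sets" "HOL-Real_Asymp.Real_Asymp"
begin

section \<open>Subsets under independent local conditions\<close>

lemma card_Pow_between:
  assumes "finite W" "Y \<subseteq> W"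
  shows "card {A. Y \<subseteq> A \<and> A \<subseteq> W} = 2 ^ (card W - card Y)"
proof -
  have "bij_betw (\<lambda>A. A \<union> Y) (Pow (W - Y)) {A. Y \<subseteq> A \<and> A \<subseteq> W}"
    by (rule bij_betw_byWitness[where f' = "\<lambda>A. A - Y"]) (use assms(2) in auto)
  then have "card {A. Y \<subseteq> A \<and> A \<subseteq> W} = card (Pow (W - Y))"
    by (simp add: bij_betw_same_card)
  also have "\<dots> = 2 ^ (card W - card Y)"
    using assms by (simp add: card_Pow card_Diff_subset finite_subset)
  finally show ?thesis .
qed

text \<open>The traces of a uniformly random subset of \<open>U\<close> on disjoint blocks are
  independent, so the probabilities, each at most \<open>\<rho>\<close>, multiply. The induction
  splits \<open>A\<close> into its parts inside and outside one block.\<close>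

lemma card_local_conditions_le:
  fixes \<rho> :: real
  assumes "finite J" "finite U"
    and "\<And>j. j \<in> J \<Longrightarrow> W j \<subseteq> U"
    and "disjoint_family_on W J"
    and "\<And>j. j \<in> J \<Longrightarrow> real (card {A. A \<subseteq> W j \<and> P j A}) \<le> \<rho> * 2 ^ card (W j)"
    and "0 \<le> \<rho>"
  shows "real (card {A. A \<subseteq> U \<and> (\<forall>j\<in>J. P j (A \<inter> W j))}) \<le> \<rho> ^ card J * 2 ^ card U"
  using assms
proof (induction J arbitrary: U rule: finite_induct)
  case empty
  have "{A. A \<subseteq> U} = Pow U" by auto
  then show ?case using empty by (simp add: card_Pow)
next
  case (insert i J)
  define F where "F = {A. A \<subseteq> U \<and> (\<forall>j\<in>insert i J. P j (A \<inter> W j))}"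
  define F1 where "F1 = {A. A \<subseteq> W i \<and> P i A}"
  define F2 where "F2 = {A. A \<subseteq> U - W i \<and> (\<forall>j\<in>J. P j (A \<inter> W j))}"
  have Wi: "W i \<subseteq> U" "finite (W i)" using insert by (auto intro: finite_subset)
  have dis: "W j \<inter> W i = {}" if "j \<in> J" for j
    using insert.prems(3) insert.hyps that by (auto simp: disjoint_family_on_def)
  have fin: "finite F1" "finite F2" using Wi insert.prems(1) by (auto simp: F1_def F2_def)
  have inj: "inj_on (\<lambda>A. (A \<inter> W i, A - W i)) F"
    by (auto simp: inj_on_def)
  have sub: "(\<lambda>A. (A \<inter> W i, A - W i)) ` F \<subseteq> F1 \<times> F2"
  proof -
    have "(A - W i) \<inter> W j = A \<inter> W j" if "j \<in> J" for A j using dis[OF that] by auto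
    then show ?thesis by (auto simp: F_def F1_def F2_def)
  qed
  have "card F \<le> card (F1 \<times> F2)"
    using card_inj_on_le[OF inj sub] fin by simp
  then have "real (card F) \<le> real (card F1) * real (card F2)"
    by (simp add: card_cartesian_product flip: of_nat_mult)
  also have "\<dots> \<le> (\<rho> * 2 ^ card (W i)) * (\<rho> ^ card J * 2 ^ card (U - W i))"
  proof (rule mult_mono)
    show "real (card F1) \<le> \<rho> * 2 ^ card (W i)" using insert.prems unfolding F1_def by auto
    show "real (card F2) \<le> \<rho> ^ card J * 2 ^ card (U - W i)"
      unfolding F2_def
    proof (rule insert.IH)
      show "W j \<subseteq> U - W i" if "j \<in> J" for j using dis[OF that] insert.prems(2) that by auto
      show "disjoint_family_on W J" using insert.prems(3) by (auto simp: disjoint_family_on_def)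
    qed (use insert.prems in auto)
  qed (use insert.prems in auto)
  also have "\<dots> = \<rho> ^ card (insert i J) * 2 ^ (card (W i) + card (U - W i))"
    using insert.hyps by (simp add: power_add)
  also have "card (W i) + card (U - W i) = card U"
    using Wi insert.prems(1) by (simp add: card_Diff_subset card_mono)
  finally show ?case unfolding F_def .
qed

section \<open>Sums with a narrow summand\<close>

text \<open>Bounds the proportion \<open>k / 2 ^ k\<close> of a union bound by 3/8, with equality at
  \<open>k = 3\<close>. Adding 1/2 for the sets that miss a given point makes 7/8.\<close>

lemma three_halves_times_power:
  assumes "3 \<le> (k::nat)" shows "8 * k \<le> 3 * 2 ^ k"
  using assms by (induction k rule: dec_induct) auto

text \<open>For three or more elements the union bound over \<open>b\<close> is good enough; for two elements it is
  not, and one counts the sets containing \<open>a\<close> but neither of \<open>a - d\<close>, \<open>a + d\<close>.\<close>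

lemma card_not_isolated_le:
  fixes B W :: "nat set"
  assumes B: "B \<subseteq> {..t}" "2 \<le> card B" and W: "finite W" "{a - t..a + t} \<subseteq> W" and ta: "t \<le> a"
  shows "real (card {A. A \<subseteq> W \<and> (a \<in> A \<longrightarrow> (\<exists>b\<in>B. \<forall>b'\<in>B. a - b + b' \<in> A))})
    \<le> 7 / 8 * 2 ^ card W"
proof -
  define G where "G = {A. A \<subseteq> W \<and> (a \<in> A \<longrightarrow> (\<exists>b\<in>B. \<forall>b'\<in>B. a - b + b' \<in> A))}"
  have finB: "finite B" using B by (auto intro: finite_subset)
  have aW: "a \<in> W" using W by auto
  show ?thesis
  proof (cases "card B = 2")
    case True
    then obtain x y where xy: "B = {x, y}" "x < y"
      by (metis card_2_iff insert_commute linorder_neqE_nat)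
    define d where "d = y - x"
    have d: "0 < d" "d \<le> a" "d \<le> t" "y = x + d" "x \<le> a" "y \<le> a"
      using xy B ta by (auto simp: d_def)
    define N where "N = {A. {a} \<subseteq> A \<and> A \<subseteq> W - {a - d, a + d}}"
    have dW: "{a - d, a + d} \<subseteq> W"
      by (rule order.trans[OF _ W(2)]) (use d in auto)
    \<comment> \<open>The only translates of \<open>{x, x + d}\<close> through \<open>a\<close> are
      \<open>{a, a + d}\<close> and \<open>{a - d, a}\<close>; members of \<open>N\<close> contain
      neither.\<close>
    have dis: "G \<inter> N = {}"
      using d by (auto simp: G_def N_def xy)
    have cW: "card {a, a - d, a + d} = 3" using d by auto
    have "card {a, a - d, a + d} \<le> card W" using dW aW W(1) by (intro card_mono) auto
    then have c3: "3 \<le> card W" using cW by simp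
    have "card (W - {a - d, a + d}) = card W - 2"
      using dW d W(1) by (subst card_Diff_subset) auto
    moreover have "card N = 2 ^ (card (W - {a - d, a + d}) - card {a})"
      unfolding N_def by (rule card_Pow_between) (use W(1) aW d in auto)
    ultimately have cN: "card N = 2 ^ (card W - 3)" by (simp add: numeral_3_eq_3 numeral_2_eq_2)
    have "card G + card N = card (G \<union> N)"
      by (rule card_Un_disjoint[symmetric])
        (use dis W(1) in \<open>auto simp: G_def N_def intro: finite_subset[of _ "Pow W"]\<close>)
    also have "\<dots> \<le> card (Pow W)"
      by (rule card_mono) (use W(1) in \<open>auto simp: G_def N_def\<close>)
    also have "\<dots> = 2 ^ (3 + (card W - 3))" using W(1) c3 by (simp add: card_Pow)
    also have "\<dots> = 8 * 2 ^ (card W - 3)" by (simp only: power_add) simp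
    finally have "card G \<le> 7 * 2 ^ (card W - 3)" using cN by simp
    then have "real (card G) \<le> 7 * 2 ^ (card W - 3)"
      by (metis (mono_tags, lifting) of_nat_le_iff of_nat_mult of_nat_numeral of_nat_power)
    moreover have "(2::real) ^ card W = 8 * 2 ^ (card W - 3)"
      using c3 by (simp flip: power_Suc add: power_diff)
    ultimately show ?thesis unfolding G_def by simp
  next
    case False
    then have k3: "3 \<le> card B" using B by simp
    define Y where "Y b = (\<lambda>b'. a - b + b') ` B" for b
    have YW: "Y b \<subseteq> W" if "b \<in> B" for b
    proof -
      have "a - b + b' \<in> {a - t..a + t}" if "b' \<in> B" for b'
        using B(1) ta \<open>b \<in> B\<close> that by (auto simp: subset_iff)
      then show ?thesis using W(2) by (auto simp: Y_def)
    qed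
    have cY: "card (Y b) = card B" for b unfolding Y_def by (rule card_image) (simp add: inj_on_def)
    have kW: "card B \<le> card W"
      using k3 YW card_mono[OF W(1)] cY by (metis card.empty ex_in_conv not_numeral_le_zero)
    \<comment> \<open>Either \<open>A\<close> misses \<open>a\<close>, which half of all subsets of
      \<open>W\<close> do, or it contains some translate \<open>Y b\<close>, which a proportion
      \<open>1 / 2 ^ card B\<close> does for each \<open>b\<close>.\<close>
    have "G \<subseteq> {A. {} \<subseteq> A \<and> A \<subseteq> W - {a}} \<union> (\<Union>b\<in>B. {A. Y b \<subseteq> A \<and> A \<subseteq> W})"
      by (auto simp: G_def Y_def image_subset_iff)
    then have "card G \<le> card ({A. {} \<subseteq> A \<and> A \<subseteq> W - {a}} \<union> (\<Union>b\<in>B. {A. Y b \<subseteq> A \<and> A \<subseteq> W}))"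
      by (rule card_mono[rotated]) (use finB W(1) in auto)
    also have "\<dots> \<le> card {A. {} \<subseteq> A \<and> A \<subseteq> W - {a}} + card (\<Union>b\<in>B. {A. Y b \<subseteq> A \<and> A \<subseteq> W})"
      by (rule card_Un_le)
    also have "\<dots> \<le> 2 ^ (card W - 1) + (\<Sum>b\<in>B. card {A. Y b \<subseteq> A \<and> A \<subseteq> W})"
      using card_Pow_between[of "W - {a}" "{}"] W(1) aW
      by (intro add_mono card_UN_le finB) (auto simp: card_Diff_subset)
    also have "(\<Sum>b\<in>B. card {A. Y b \<subseteq> A \<and> A \<subseteq> W}) = (\<Sum>b\<in>B. 2 ^ (card W - card B))"
      by (intro sum.cong refl) (simp add: card_Pow_between W(1) YW cY)
    also have "\<dots> = card B * 2 ^ (card W - card B)" by simp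
    finally have "8 * card G \<le> 8 * 2 ^ (card W - 1) + (8 * card B) * 2 ^ (card W - card B)"
      by simp
    also have "\<dots> \<le> 8 * 2 ^ (card W - 1) + (3 * 2 ^ card B) * 2 ^ (card W - card B)"
      by (intro add_mono mult_right_mono three_halves_times_power k3) auto
    also have "\<dots> = 4 * 2 ^ card W + 3 * 2 ^ card W"
    proof -
      have "(2::nat) ^ card B * 2 ^ (card W - card B) = 2 ^ card W"
        using kW by (simp flip: power_add)
      moreover have "2 * 2 ^ (card W - 1) = (2::nat) ^ card W"
        using kW k3 by (simp flip: power_Suc)
      ultimately show ?thesis by simp
    qed
    finally have "8 * card G \<le> 7 * 2 ^ card W" by simp
    then have "real (8 * card G) \<le> real (7 * 2 ^ card W)" by (simp only: of_nat_le_iff)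
    then show ?thesis unfolding G_def by simp
  qed
qed

text \<open>Cut \<open>{..n}\<close> into disjoint windows of length \<open>2 * t + 1\<close>. A
  translate of \<open>B\<close> through the centre of a window stays inside that window, so the
  conditions at the centres are independent, each of probability at most 7/8.\<close>

lemma card_covered_by_translates_le:
  fixes B :: "nat set"
  assumes B: "B \<subseteq> {..t}" "2 \<le> card B"
  shows "real (card {A. A \<subseteq> {..n} \<and> (\<forall>a\<in>A. \<exists>b\<in>B. \<forall>b'\<in>B. a - b + b' \<in> A)})
    \<le> (7 / 8) ^ ((n + 1) div (2 * t + 1)) * 2 ^ (n + 1)"
proof -
  define l where "l = 2 * t + 1"
  \<comment> \<open>Only complete windows count; the elements left over at the end stay
    unconstrained.\<close>
  define r where "r = (n + 1) div l"
  define W where "W j = {l * j..<l * j + l}" for j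
  define c where "c j = l * j + t" for j
  define P where "P j A \<longleftrightarrow> (c j \<in> A \<longrightarrow> (\<exists>b\<in>B. \<forall>b'\<in>B. c j - b + b' \<in> A))" for j A
  have bt: "b \<le> t" if "b \<in> B" for b using B that by auto
  have WU: "W j \<subseteq> {..n}" if "j < r" for j
  proof -
    have "l * j + l \<le> l * r" using mult_le_mono2[of "Suc j" r l] that by simp
    also have "\<dots> \<le> n + 1" by (simp add: r_def)
    finally show ?thesis by (auto simp: W_def)
  qed
  have "W i \<inter> W j = {}" if "i \<noteq> j" for i j
  proof -
    have "x div l = k" if "x \<in> W k" for x k
      using that by (intro div_nat_eqI) (auto simp: W_def algebra_simps)
    then show ?thesis using that by blast
  qed
  then have disW: "disjoint_family_on W {..<r}" by (simp add: disjoint_family_on_def)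
  have "real (card {A. A \<subseteq> {..n} \<and> (\<forall>j\<in>{..<r}. P j (A \<inter> W j))})
      \<le> (7 / 8) ^ card {..<r} * 2 ^ card {..n}"
  proof (rule card_local_conditions_le)
    show "real (card {A. A \<subseteq> W j \<and> P j A}) \<le> 7 / 8 * 2 ^ card (W j)" for j
      unfolding P_def
      by (rule card_not_isolated_le[OF B]) (auto simp: W_def c_def l_def)
  qed (use WU disW in auto)
  moreover have "card {A. A \<subseteq> {..n} \<and> (\<forall>a\<in>A. \<exists>b\<in>B. \<forall>b'\<in>B. a - b + b' \<in> A)}
      \<le> card {A. A \<subseteq> {..n} \<and> (\<forall>j\<in>{..<r}. P j (A \<inter> W j))}"
  proof (intro card_mono subsetI)
    have inW: "c j - b + b' \<in> W j" if "b \<in> B" "b' \<in> B" for j b b'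
      using bt[OF that(1)] bt[OF that(2)] by (auto simp: W_def c_def l_def)
    fix A assume A: "A \<in> {A. A \<subseteq> {..n} \<and> (\<forall>a\<in>A. \<exists>b\<in>B. \<forall>b'\<in>B. a - b + b' \<in> A)}"
    have "P j (A \<inter> W j)" for j
      unfolding P_def
    proof
      assume "c j \<in> A \<inter> W j"
      then obtain b where "b \<in> B" "\<forall>b'\<in>B. c j - b + b' \<in> A" using A by blast
      then show "\<exists>b\<in>B. \<forall>b'\<in>B. c j - b + b' \<in> A \<inter> W j" using inW by blast
    qed
    then show "A \<in> {A. A \<subseteq> {..n} \<and> (\<forall>j\<in>{..<r}. P j (A \<inter> W j))}" using A by blast
  qed simp
  ultimately show ?thesis by (simp add: r_def l_def)
qed

section \<open>Sums of two wide summands\<close>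

text \<open>The sum misses \<open>k\<close> exactly when no \<open>i\<close> has both
  \<open>i \<in> B\<close> and \<open>k - i \<in> C\<close>. For different \<open>i\<close> these
  conditions concern disjoint pairs of membership choices, each has probability 3/4, and at least
  \<open>t\<close> values of \<open>i\<close> are available.\<close>

lemma card_pairs_missing_sum_le:
  fixes k p q t :: nat
  assumes t: "t \<le> p" "t \<le> q" and k: "t \<le> k" "k + t \<le> p + q"
  shows "real (card {(B, C). B \<subseteq> {..p} \<and> C \<subseteq> {..q} \<and> k \<notin> B + C})
    \<le> (3 / 4) ^ t * 2 ^ (p + q + 2)"
proof -
  \<comment> \<open>These are the \<open>i\<close> with \<open>i \<le> p\<close>,
    \<open>i \<le> k\<close> and \<open>k - i \<le> q\<close>; truncated subtraction puts the lower
    end at 0 when \<open>k < q\<close>.\<close>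
  define I where "I = {k - q..min p k}"
  \<comment> \<open>A pair \<open>(B, C)\<close> becomes the single subset \<open>B <+> C\<close> of
    a disjoint sum, so that \<open>card_local_conditions_le\<close> applies.\<close>
  define U :: "(nat + nat) set" where "U = {..p} <+> {..q}"
  define W :: "nat \<Rightarrow> (nat + nat) set" where "W i = {Inl i, Inr (k - i)}" for i
  define F where "F = {A. A \<subseteq> U \<and> (\<forall>i\<in>I. A \<inter> W i \<noteq> W i)}"
  have tI: "t \<le> card I" using t k by (auto simp: I_def min_def)
  have "real (card F) \<le> (3 / 4) ^ card I * 2 ^ card U"
    unfolding F_def
  proof (rule card_local_conditions_le)
    show "W i \<subseteq> U" if "i \<in> I" for i using that by (auto simp: W_def U_def I_def)
    show "disjoint_family_on W I"
      by (auto simp: disjoint_family_on_def W_def I_def)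
    show "real (card {A. A \<subseteq> W i \<and> A \<noteq> W i}) \<le> 3 / 4 * 2 ^ card (W i)" for i
    proof -
      have "{A. A \<subseteq> W i \<and> A \<noteq> W i} = Pow (W i) - {W i}" by auto
      then have "card {A. A \<subseteq> W i \<and> A \<noteq> W i} = 2 ^ card (W i) - 1"
        by (simp add: card_Diff_subset card_Pow W_def)
      moreover have "card (W i) = 2" by (simp add: W_def)
      ultimately show ?thesis by simp
    qed
  qed (auto simp: I_def U_def)
  also have "\<dots> \<le> (3 / 4) ^ t * 2 ^ card U"
    using tI by (intro mult_right_mono power_decreasing) auto
  also have "card U = p + q + 2" by (simp add: U_def card_Plus)
  finally have "real (card F) \<le> (3 / 4) ^ t * 2 ^ (p + q + 2)" .
  moreover have "card {(B, C). B \<subseteq> {..p} \<and> C \<subseteq> {..q} \<and> k \<notin> B + C} \<le> card F"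
  proof (rule card_inj_on_le)
    show "inj_on (\<lambda>(B, C). B <+> C) {(B, C). B \<subseteq> {..p} \<and> C \<subseteq> {..q} \<and> k \<notin> B + C}"
      by (auto simp: inj_on_def)
    show "(\<lambda>(B, C). B <+> C) ` {(B, C). B \<subseteq> {..p} \<and> C \<subseteq> {..q} \<and> k \<notin> B + C} \<subseteq> F"
    proof clarify
      fix B C assume BC: "B \<subseteq> {..p}" "C \<subseteq> {..q}" "k \<notin> B + C"
      have "\<not> (i \<in> B \<and> k - i \<in> C)" if "i \<in> I" for i
        using BC(3) set_plus_intro[of i B "k - i" C] that by (auto simp: I_def)
      then show "B <+> C \<in> F" using BC(1,2) by (fastforce simp: F_def U_def W_def)
    qed
    show "finite F" by (simp add: F_def U_def)
  qed
  ultimately show ?thesis by linarith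
qed

text \<open>A sumset containing all of \<open>M\<close> is determined by its trace on the
  \<open>2 * t\<close> outer points, which gives \<open>4 ^ t\<close>. Every other sumset comes from
  a pair missing some \<open>k\<close> in \<open>M\<close>, and such pairs are few.\<close>

lemma card_sumsets_le:
  fixes p q t :: nat
  assumes t: "t \<le> p" "t \<le> q"
  shows "real (card {B + C | B C. B \<subseteq> {..p} \<and> C \<subseteq> {..q}})
    \<le> 4 ^ t + (p + q + 1) * ((3 / 4) ^ t * 2 ^ (p + q + 2))"
proof -
  define M where "M = {t..p + q - t}"
  define bad where "bad k = {(B, C). B \<subseteq> {..p} \<and> C \<subseteq> {..q} \<and> k \<notin> B + C}" for k
  define good where "good = {D. M \<subseteq> D \<and> D \<subseteq> {..p + q}}"
  have finbad: "finite (bad k)" for k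
    by (rule finite_subset[of _ "Pow {..p} \<times> Pow {..q}"]) (auto simp: bad_def)
  have fingood: "finite good" by (auto simp: good_def)
  have cgood: "card good = 4 ^ t"
  proof -
    have "card good = 2 ^ (card {..p + q} - card M)"
      unfolding good_def by (rule card_Pow_between) (auto simp: M_def)
    also have "card {..p + q} - card M = 2 * t" using t by (simp add: M_def)
    finally show ?thesis by (simp add: power_mult)
  qed
  have "{B + C | B C. B \<subseteq> {..p} \<and> C \<subseteq> {..q}} \<subseteq> good \<union> (\<Union>k\<in>M. (\<lambda>(B, C). B + C) ` bad k)"
  proof clarify
    fix B C assume BC: "B \<subseteq> {..p}" "C \<subseteq> {..q}" "B + C \<notin> (\<Union>k\<in>M. (\<lambda>(B, C). B + C) ` bad k)"
    have "B + C \<subseteq> {..p + q}" using BC(1,2) by (auto simp: set_plus_def intro: add_mono)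
    moreover have "k \<in> B + C" if "k \<in> M" for k
    proof (rule ccontr)
      assume "k \<notin> B + C"
      then have "(B, C) \<in> bad k" using BC by (auto simp: bad_def)
      then show False using BC(3) that by force
    qed
    ultimately show "B + C \<in> good" by (auto simp: good_def)
  qed
  then have "card {B + C | B C. B \<subseteq> {..p} \<and> C \<subseteq> {..q}}
      \<le> card (good \<union> (\<Union>k\<in>M. (\<lambda>(B, C). B + C) ` bad k))"
    by (rule card_mono[rotated]) (use fingood finbad in \<open>auto simp: M_def\<close>)
  also have "\<dots> \<le> card good + card (\<Union>k\<in>M. (\<lambda>(B, C). B + C) ` bad k)" by (rule card_Un_le)
  also have "\<dots> \<le> 4 ^ t + (\<Sum>k\<in>M. card (bad k))"
    unfolding cgood
    by (intro add_left_mono order.trans[OF card_UN_le] sum_mono card_image_le finbad) (simp add: M_def)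
  finally have "real (card {B + C | B C. B \<subseteq> {..p} \<and> C \<subseteq> {..q}})
      \<le> real (4 ^ t + (\<Sum>k\<in>M. card (bad k)))" by (simp only: of_nat_le_iff)
  also have "\<dots> = 4 ^ t + (\<Sum>k\<in>M. real (card (bad k)))" by simp
  also have "(\<Sum>k\<in>M. real (card (bad k))) \<le> (\<Sum>k\<in>M. (3 / 4) ^ t * 2 ^ (p + q + 2))"
    unfolding bad_def by (intro sum_mono card_pairs_missing_sum_le t) (use t in \<open>auto simp: M_def\<close>)
  also have "\<dots> = card M * ((3 / 4) ^ t * 2 ^ (p + q + 2))" by simp
  also have "\<dots> \<le> (p + q + 1) * ((3 / 4) ^ t * 2 ^ (p + q + 2))"
    by (intro mult_right_mono) (auto simp: M_def)
  finally show ?thesis by simp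
qed

section \<open>Decomposable sets are negligible\<close>

text \<open>The summands are arbitrary sets of naturals, not only subsets of a given monoid, so one
  estimate serves all cases. Infinite summands are excluded because their \<open>card\<close> is
  0.\<close>

definition decomposable :: "nat set \<Rightarrow> bool" where
  "decomposable A \<longleftrightarrow> (\<exists>B C. 2 \<le> card B \<and> 2 \<le> card C \<and> A = B + C)"

text \<open>Shift both summands to minimum 0. If one has width at most \<open>t\<close>, it serves
  as the narrow \<open>B\<close>, since each element of a sumset lies in a translate of either
  summand inside the sumset. Otherwise both are wide and \<open>u\<close> collects the two
  minima.\<close>

lemma decomposable_cases:
  assumes "decomposable A" "A \<subseteq> {..n}"
  obtains (narrow) B where "B \<subseteq> {..t}" "2 \<le> card B"
      "\<forall>a\<in>A. \<exists>b\<in>B. \<forall>b'\<in>B. a - b + b' \<in> A"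
  | (wide) u p q B C where "t \<le> p" "t \<le> q" "u + p + q \<le> n" "B \<subseteq> {..p}" "C \<subseteq> {..q}"
      "A = (+) u ` (B + C)"
proof -
  \<comment> \<open>For \<open>a = b + c\<close> the translate used is \<open>B\<close> shifted by
    \<open>c\<close>, which passes through \<open>a\<close> at the element \<open>b\<close>.\<close>
  have covered: "\<forall>a\<in>A. \<exists>b\<in>(\<lambda>x. x - Min B) ` B. \<forall>b'\<in>(\<lambda>x. x - Min B) ` B. a - b + b' \<in> A"
    if A: "A = B + C" and B: "finite B" for B C :: "nat set"
  proof
    fix a assume "a \<in> A"
    then obtain b c where bc: "a = b + c" "b \<in> B" "c \<in> C" unfolding A by (rule set_plus_elim)
    have "a - (b - Min B) + (b' - Min B) = b' + c" if "b' \<in> B" for b'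
      using Min_le[OF B that] Min_le[OF B bc(2)] bc(1) by simp
    then show "\<exists>b\<in>(\<lambda>x. x - Min B) ` B. \<forall>b'\<in>(\<lambda>x. x - Min B) ` B. a - b + b' \<in> A"
      using bc unfolding A by (auto intro!: bexI[of _ b])
  qed
  have card: "card ((\<lambda>x. x - Min B) ` B) = card B" if "finite B" for B :: "nat set"
    by (rule card_image, rule inj_on_diff_nat) (use that in auto)
  obtain B C where BC: "2 \<le> card B" "2 \<le> card C" "A = B + C"
    using assms(1) by (auto simp: decomposable_def)
  have fin: "finite B" "finite C" using BC by (auto intro: card_ge_0_finite)
  have ne: "B \<noteq> {}" "C \<noteq> {}" using BC by auto
  define p where "p = Max B - Min B"
  define q where "q = Max C - Min C"
  have sub: "(\<lambda>x. x - Min B) ` B \<subseteq> {..p}" "(\<lambda>x. x - Min C) ` C \<subseteq> {..q}"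
    using fin by (auto simp: p_def q_def intro: diff_le_mono)
  consider "p \<le> t" | "q \<le> t" | "t \<le> p" "t \<le> q" by linarith
  then show ?thesis
  proof cases
    case 1
    show ?thesis
      by (rule narrow[OF _ _ covered[OF BC(3) fin(1)]]) (use sub 1 fin card BC in auto)
  next
    case 2
    have "A = C + B" using BC by (simp add: add.commute)
    show ?thesis
      by (rule narrow[OF _ _ covered[OF \<open>A = C + B\<close> fin(2)]]) (use sub 2 fin card BC in auto)
  next
    case 3
    \<comment> \<open>This element equals \<open>u + p + q\<close> for
      \<open>u = Min B + Min C\<close>, so its membership in \<open>A\<close> yields the bound by
      \<open>n\<close>.\<close>
    have "Max B + Max C \<in> A" unfolding BC(3) using fin ne by (intro set_plus_intro Max_in)
    then have "Max B + Max C \<le> n" using assms by auto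
    moreover have "Min B \<le> Max B" "Min C \<le> Max C" using fin ne by auto
    ultimately have le: "(Min B + Min C) + p + q \<le> n" by (simp add: p_def q_def)
    have "A = (+) (Min B + Min C) ` ((\<lambda>x. x - Min B) ` B + (\<lambda>x. x - Min C) ` C)"
    proof -
      have eq: "b + c = (Min B + Min C) + ((b - Min B) + (c - Min C))" if "b \<in> B" "c \<in> C" for b c
        using Min_le[OF fin(1) that(1)] Min_le[OF fin(2) that(2)] by simp
      show ?thesis unfolding BC
      proof (intro equalityI subsetI)
        fix x assume "x \<in> B + C"
        then obtain b c where bc: "x = b + c" "b \<in> B" "c \<in> C" by (rule set_plus_elim)
        show "x \<in> (+) (Min B + Min C) ` ((\<lambda>x. x - Min B) ` B + (\<lambda>x. x - Min C) ` C)"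
          unfolding bc(1) eq[OF bc(2,3)] by (intro imageI set_plus_intro bc(2,3))
      next
        fix x assume "x \<in> (+) (Min B + Min C) ` ((\<lambda>x. x - Min B) ` B + (\<lambda>x. x - Min C) ` C)"
        then obtain b c where bc: "x = (Min B + Min C) + ((b - Min B) + (c - Min C))" "b \<in> B" "c \<in> C"
          by (auto elim!: set_plus_elim)
        show "x \<in> B + C"
          unfolding bc(1) eq[OF bc(2,3), symmetric] by (rule set_plus_intro[OF bc(2,3)])
      qed
    qed
    then show ?thesis using wide 3 le sub by blast
  qed
qed

text \<open>Union bound over at most \<open>2 ^ (t + 1)\<close> narrow summands and at most
  \<open>(n + 1) ^ 3\<close> triples \<open>(u, p, q)\<close>; shifting by a fixed \<open>u\<close>
  does not increase the number of sumsets.\<close>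

lemma card_decomposable_le:
  "real (card {A. A \<subseteq> {..n} \<and> decomposable A})
    \<le> 2 ^ (t + 1) * ((7 / 8) ^ ((n + 1) div (2 * t + 1)) * 2 ^ (n + 1))
      + (real n + 1) ^ 3 * (4 ^ t + (real n + 1) * ((3 / 4) ^ t * 2 ^ (n + 2)))"
proof -
  define BB where "BB = {B. B \<subseteq> {..t} \<and> 2 \<le> card B}"
  define E where "E B = {A. A \<subseteq> {..n} \<and> (\<forall>a\<in>A. \<exists>b\<in>B. \<forall>b'\<in>B. a - b + b' \<in> A)}" for B
  define Q where "Q = {(u, p, q). t \<le> p \<and> t \<le> q \<and> u + p + q \<le> n}"
  define Sums where "Sums p q = {B + C | B C. B \<subseteq> {..p} \<and> C \<subseteq> {..q}}" for p q :: nat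
  define F where "F = (\<lambda>(u, p, q). ((`) ((+) u)) ` Sums p q)"
  have finBB: "finite BB" by (auto simp: BB_def)
  have cBB: "card BB \<le> 2 ^ (t + 1)"
  proof -
    have "card BB \<le> card (Pow {..t})" by (rule card_mono) (auto simp: BB_def)
    then show ?thesis by (simp add: card_Pow)
  qed
  have QQ: "Q \<subseteq> {..n} \<times> {..n} \<times> {..n}" by (auto simp: Q_def)
  have finQ: "finite Q" using QQ by (rule finite_subset) auto
  have cQ: "card Q \<le> (n + 1) ^ 3"
    using card_mono[OF _ QQ] by (simp add: card_cartesian_product power3_eq_cube algebra_simps)
  have finSums: "finite (Sums p q)" for p q
  proof -
    have "Sums p q = (\<lambda>(B, C). B + C) ` (Pow {..p} \<times> Pow {..q})" by (auto simp: Sums_def)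
    then show ?thesis by simp
  qed
  have "{A. A \<subseteq> {..n} \<and> decomposable A} \<subseteq> (\<Union>B\<in>BB. E B) \<union> (\<Union>x\<in>Q. F x)"
  proof clarify
    fix A assume A: "A \<subseteq> {..n}" "decomposable A" "A \<notin> (\<Union>x\<in>Q. F x)"
    from A(2,1) show "A \<in> (\<Union>B\<in>BB. E B)"
    proof (cases rule: decomposable_cases[where t = t])
      case (narrow B)
      then show ?thesis using A(1) by (auto simp: BB_def E_def)
    next
      case (wide u p q B C)
      then have "B + C \<in> Sums p q" "(u, p, q) \<in> Q" by (auto simp: Sums_def Q_def)
      then have "A \<in> (\<Union>x\<in>Q. F x)" using wide(6) by (force simp: F_def)
      then show ?thesis using A(3) by blast
    qed
  qed
  then have "card {A. A \<subseteq> {..n} \<and> decomposable A} \<le> card ((\<Union>B\<in>BB. E B) \<union> (\<Union>x\<in>Q. F x))"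
    by (rule card_mono[rotated]) (use finBB finQ finSums in \<open>auto simp: E_def F_def\<close>)
  also have "\<dots> \<le> card (\<Union>B\<in>BB. E B) + card (\<Union>x\<in>Q. F x)" by (rule card_Un_le)
  also have "\<dots> \<le> (\<Sum>B\<in>BB. card (E B)) + (\<Sum>x\<in>Q. card (F x))"
    by (intro add_mono card_UN_le finBB finQ)
  finally have "real (card {A. A \<subseteq> {..n} \<and> decomposable A})
      \<le> real ((\<Sum>B\<in>BB. card (E B)) + (\<Sum>x\<in>Q. card (F x)))" by (simp only: of_nat_le_iff)
  also have "\<dots> = (\<Sum>B\<in>BB. real (card (E B))) + (\<Sum>x\<in>Q. real (card (F x)))" by simp
  also have "\<dots> \<le> (\<Sum>B\<in>BB. (7 / 8) ^ ((n + 1) div (2 * t + 1)) * 2 ^ (n + 1))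
      + (\<Sum>x\<in>Q. 4 ^ t + (n + 1) * ((3 / 4) ^ t * 2 ^ (n + 2)))"
  proof (intro add_mono sum_mono)
    fix B assume "B \<in> BB"
    then show "real (card (E B)) \<le> (7 / 8) ^ ((n + 1) div (2 * t + 1)) * 2 ^ (n + 1)"
      unfolding E_def BB_def by (intro card_covered_by_translates_le) auto
  next
    fix x assume "x \<in> Q"
    then obtain u p q where x: "x = (u, p, q)" "t \<le> p" "t \<le> q" "u + p + q \<le> n"
      by (auto simp: Q_def)
    have "card (F x) \<le> card (Sums p q)" unfolding F_def x(1) by (simp add: card_image_le finSums)
    then have "real (card (F x)) \<le> real (card (Sums p q))" by simp
    also have "\<dots> \<le> 4 ^ t + (p + q + 1) * ((3 / 4) ^ t * 2 ^ (p + q + 2))"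
      unfolding Sums_def by (rule card_sumsets_le[OF x(2,3)])
    also have "\<dots> \<le> 4 ^ t + (n + 1) * ((3 / 4) ^ t * 2 ^ (n + 2))"
      using x(4) by (intro add_left_mono mult_mono mult_left_mono power_increasing) auto
    finally show "real (card (F x)) \<le> 4 ^ t + (n + 1) * ((3 / 4) ^ t * 2 ^ (n + 2))" .
  qed
  also have "\<dots> = card BB * ((7 / 8) ^ ((n + 1) div (2 * t + 1)) * 2 ^ (n + 1))
      + card Q * (4 ^ t + (n + 1) * ((3 / 4) ^ t * 2 ^ (n + 2)))" by simp
  also have "\<dots> \<le> 2 ^ (t + 1) * ((7 / 8) ^ ((n + 1) div (2 * t + 1)) * 2 ^ (n + 1))
      + (n + 1) ^ 3 * (4 ^ t + (n + 1) * ((3 / 4) ^ t * 2 ^ (n + 2)))"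
  proof (intro add_mono mult_right_mono)
    show "real (card BB) \<le> 2 ^ (t + 1)" using cBB by (metis of_nat_le_iff of_nat_numeral of_nat_power)
    show "real (card Q) \<le> real ((n + 1) ^ 3)" using cQ by (simp only: of_nat_le_iff)
  qed auto
  finally show ?thesis by (simp add: add_ac)
qed

lemma card_decomposable_negligible:
  "(\<lambda>n. real (card {A. A \<subseteq> {..n} \<and> decomposable A}) / 2 ^ n) \<longlonglongrightarrow> 0"
proof (rule tendsto_sandwich[OF _ _ tendsto_const])
  \<comment> \<open>The width \<open>t\<close> is the integer part of \<open>?y n\<close>. It
    outgrows the logarithm, so \<open>(3 / 4) ^ t\<close> beats the polynomial factors, and stays
    below the square root, so 7/8 to a power of order \<open>n / t\<close> beats
    \<open>2 ^ t\<close>.\<close>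
  let ?y = "\<lambda>n. real n powr (1 / 3)"
  let ?f = "\<lambda>n. 4 * (2 powr ?y n * (7 / 8) powr (real n / (2 * ?y n + 1) - 1))
    + (real n + 1) ^ 3 * (4 powr ?y n / 2 powr real n) + 4 * (real n + 1) ^ 4 * (3 / 4) powr (?y n - 1)"
  show "\<forall>\<^sub>F n in sequentially. real (card {A. A \<subseteq> {..n} \<and> decomposable A}) / 2 ^ n \<le> ?f n"
  proof (rule always_eventually, rule allI)
    fix n :: nat
    define y where "y = ?y n"
    define t where "t = nat \<lfloor>y\<rfloor>"
    define r where "r = (n + 1) div (2 * t + 1)"
    have y: "0 \<le> y" by (simp add: y_def)
    have t: "real t \<le> y" "y - 1 \<le> real t" using y by (simp_all add: t_def)
    \<comment> \<open>Rounding the quotient down loses less than 1; with \<open>t \<le> y\<close>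
      this gives the exponent of 7/8 in \<open>?f\<close>.\<close>
    have "n + 1 < (2 * t + 1) + r * (2 * t + 1)"
      unfolding r_def by (rule dividend_less_div_times) simp
    then have "n + 1 \<le> (r + 1) * (2 * t + 1)" by (simp add: algebra_simps)
    then have "real (n + 1) \<le> real ((r + 1) * (2 * t + 1))" by (simp only: of_nat_le_iff)
    then have "real n \<le> (real r + 1) * (2 * real t + 1)" by (simp add: algebra_simps)
    also have "\<dots> \<le> (real r + 1) * (2 * y + 1)" using t by (intro mult_left_mono) auto
    finally have r: "real n / (2 * y + 1) - 1 \<le> real r" using y by (simp add: field_simps)
    have b1: "2 ^ t \<le> 2 powr y" "4 ^ t \<le> 4 powr y" using t by (simp_all flip: powr_realpow)
    \<comment> \<open>For bases below 1 upper bounds come from lower bounds on the exponents, here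
      and in \<open>b3\<close>.\<close>
    have b2: "(3 / 4) ^ t \<le> (3 / 4 :: real) powr (y - 1)"
      using t powr_mono'[of "y - 1" "real t" "3 / 4"] by (simp add: powr_realpow)
    have b3: "(7 / 8) ^ r \<le> (7 / 8 :: real) powr (real n / (2 * y + 1) - 1)"
      using r powr_mono'[of "real n / (2 * y + 1) - 1" "real r" "7 / 8"] by (simp add: powr_realpow)
    have "real (card {A. A \<subseteq> {..n} \<and> decomposable A}) / 2 ^ n
        \<le> (2 ^ (t + 1) * ((7 / 8) ^ r * 2 ^ (n + 1))
      + (real n + 1) ^ 3 * (4 ^ t + (real n + 1) * ((3 / 4) ^ t * 2 ^ (n + 2)))) / 2 ^ n"
      unfolding r_def by (intro divide_right_mono card_decomposable_le) auto
    also have "\<dots> = 4 * (2 ^ t * (7 / 8) ^ r) + (real n + 1) ^ 3 * (4 ^ t / 2 powr real n)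
        + 4 * (real n + 1) ^ 4 * (3 / 4) ^ t"
    proof -
      \<comment> \<open>Stated for arbitrary reals so that simplification treats the powers as
        opaque.\<close>
      have "(2 * T * (R * (2 * N)) + m ^ 3 * (F + m * (Q * (4 * N)))) / N
          = 4 * (T * R) + m ^ 3 * (F / N) + 4 * m ^ 4 * Q" if "N \<noteq> 0" for T R N m F Q :: real
        using that by (simp add: field_simps eval_nat_numeral)
      from this[of "2 ^ n" "2 ^ t" "(7 / 8) ^ r" "real n + 1" "4 ^ t" "(3 / 4) ^ t"]
      show ?thesis by (simp add: powr_realpow algebra_simps)
    qed
    also have "\<dots> \<le> 4 * (2 powr y * (7 / 8) powr (real n / (2 * y + 1) - 1))
        + (real n + 1) ^ 3 * (4 powr y / 2 powr real n)
        + 4 * (real n + 1) ^ 4 * (3 / 4) powr (y - 1)"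
      by (intro add_mono mult_mono mult_left_mono divide_right_mono b1 b2 b3) auto
    finally show "real (card {A. A \<subseteq> {..n} \<and> decomposable A}) / 2 ^ n \<le> ?f n" by (simp add: y_def)
  qed
  show "?f \<longlonglongrightarrow> 0" by (intro tendsto_add_zero; real_asymp)
qed auto

section \<open>Cofiniteness of numerical monoids\<close>

text \<open>The least positive difference \<open>d\<close> of two elements divides every element,
  hence the gcd, so \<open>d = 1\<close>. With two consecutive elements \<open>b\<close> and
  \<open>b + 1\<close>, every sufficiently large number is a combination of them.\<close>

lemma numerical_monoid_conductor:
  assumes "numerical_monoid S"
  obtains c where "0 < c" "\<And>n. c \<le> n \<Longrightarrow> n \<in> S"
proof -
  have S0: "0 \<in> S" and Sadd: "\<And>a b. a \<in> S \<Longrightarrow> b \<in> S \<Longrightarrow> a + b \<in> S" and G: "Gcd S = 1"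
    using assms by (auto simp: numerical_monoid_def additive_submonoid_def)
  have Smult: "k * a \<in> S" if "a \<in> S" for a k
    using that by (induction k) (auto intro: S0 Sadd)
  have "\<not> S \<subseteq> {0}" using G by (metis Gcd_0_iff zero_neq_one)
  then obtain e where e: "e \<in> S" "0 < e" by auto
  define D where "D d \<longleftrightarrow> 0 < d \<and> (\<exists>b\<in>S. b + d \<in> S)" for d
  define d where "d = (LEAST d. D d)"
  have "D e" using e S0 by (auto simp: D_def intro!: bexI[of _ 0])
  then have "D d" unfolding d_def by (rule LeastI)
  then obtain b where b: "0 < d" "b \<in> S" "b + d \<in> S" by (auto simp: D_def)
  have "d dvd s" if s: "s \<in> S" for s
  proof (rule ccontr)
    assume "\<not> d dvd s"
    then have r: "0 < s mod d" by (auto simp: dvd_eq_mod_eq_0)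
    \<comment> \<open>Exhibits the remainder \<open>s mod d\<close> as a difference of two elements
      of \<open>S\<close>, against the minimality of \<open>d\<close>.\<close>
    have "(s div d) * (b + d) + s mod d = s + (s div d) * b"
      by (simp add: algebra_simps)
    then have "(s div d) * (b + d) + s mod d \<in> S" using Smult[OF b(2)] Sadd s by simp
    then have "D (s mod d)" unfolding D_def using r Smult[OF b(3)] by blast
    then have "d \<le> s mod d" unfolding d_def by (rule Least_le)
    then show False using b(1) mod_less_divisor[of d s] by linarith
  qed
  then have "d dvd Gcd S" by (rule Gcd_greatest)
  then have "d = 1" using G by simp
  then have b1: "b + 1 \<in> S" using b by simp
  have "n \<in> S" if "b * b + 1 \<le> n" for n
  proof (cases "b = 0")
    case True
    then show ?thesis using Smult[OF b1, of n] by simp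
  next
    case False
    define q where "q = n div b"
    define r where "r = n mod b"
    have "b \<le> q" using that False by (simp add: q_def less_eq_div_iff_mult_less_eq)
    moreover have "r < b" using False by (simp add: r_def)
    moreover have "n = q * b + r" by (simp add: q_def r_def)
    \<comment> \<open>Because \<open>r < b \<le> q\<close>, the subtraction \<open>q - r\<close> is
      not truncated.\<close>
    ultimately have "n = (q - r) * b + r * (b + 1)"
      by (simp add: diff_mult_distrib)
    then show ?thesis using Smult[OF b(2), of "q - r"] Smult[OF b1, of r] Sadd by metis
  qed
  then show ?thesis using that[of "b * b + 1"] by simp
qed

section \<open>Reduction to subsets of initial segments\<close>

text \<open>Maxima are natural numbers, so for nonnegative \<open>x\<close> the density at
  \<open>x\<close> equals the density at its floor, and the limit along the naturals
  suffices.\<close>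

lemma tendsto_atom_densityI:
  assumes "(\<lambda>n. atom_density H (real n)) \<longlonglongrightarrow> L"
  shows "(atom_density H \<longlongrightarrow> L) at_top"
proof -
  have eq: "atom_density H (real (nat \<lfloor>x\<rfloor>)) = atom_density H x" if "0 \<le> x" for x
  proof -
    have "real m \<le> x \<longleftrightarrow> real m \<le> real (nat \<lfloor>x\<rfloor>)" for m
      using that le_floor_iff[of "int m" x] by (simp, metis of_int_le_iff of_int_of_nat_eq)
    then show ?thesis unfolding atom_density_def by presburger
  qed
  have ev: "\<forall>\<^sub>F x in at_top. atom_density H (real (nat \<lfloor>x\<rfloor>)) = atom_density H x"
    by (rule eventually_at_top_linorderI[of 0]) (rule eq)
  have "filterlim (\<lambda>x::real. nat \<lfloor>x\<rfloor>) sequentially at_top"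
    by (rule filterlim_compose[OF filterlim_nat_sequentially filterlim_floor_sequentially])
  from filterlim_compose[OF assms this]
  have "((\<lambda>x::real. atom_density H (real (nat \<lfloor>x\<rfloor>))) \<longlongrightarrow> L) at_top" .
  then show ?thesis using ev by (rule Lim_transform_eventually)
qed

lemma atom_density_of_nat:
  "atom_density H (real n) = real (card {A \<in> atoms H. Max A \<le> n}) / real (card {A \<in> H. Max A \<le> n})"
  by (simp add: atom_density_def)

lemma Max_le_iff_subset_atMost:
  "finite A \<Longrightarrow> A \<noteq> {} \<Longrightarrow> Max A \<le> n \<longleftrightarrow> A \<subseteq> {..n::nat}"
  by auto

lemma power_monoid_Max_le:
  fixes S :: "nat set"
  shows
  "{A \<in> power_monoid S. Max A \<le> n} = Pow (S \<inter> {..n}) - {{}}"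
proof -
  have fin: "finite A" if "A \<subseteq> {..n}" for A using that by (rule finite_subset) simp
  show ?thesis
  proof (rule set_eqI)
    fix A show "A \<in> {A \<in> power_monoid S. Max A \<le> n} \<longleftrightarrow> A \<in> Pow (S \<inter> {..n}) - {{}}"
    proof (cases "finite A \<and> A \<noteq> {}")
      case True
      then show ?thesis using Max_le_iff_subset_atMost[of A n] by (auto simp: power_monoid_def)
    next
      case False
      then show ?thesis using fin[of A] by (auto simp: power_monoid_def)
    qed
  qed
qed

lemma restricted_power_monoid_Max_le:
  fixes S :: "nat set"
  shows
  "0 \<in> S \<Longrightarrow> {A \<in> restricted_power_monoid S. Max A \<le> n} = {A. {0} \<subseteq> A \<and> A \<subseteq> S \<inter> {..n}}"
proof -
  assume "0 \<in> S"
  have "{A \<in> restricted_power_monoid S. Max A \<le> n} = {A \<in> Pow (S \<inter> {..n}) - {{}}. 0 \<in> A}"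
    unfolding power_monoid_Max_le[symmetric] by (auto simp: restricted_power_monoid_def)
  then show ?thesis by auto
qed

text \<open>\<open>S\<close> misses at most \<open>c\<close> naturals, so whatever is negligible
  against \<open>2 ^ n\<close> is negligible against the number of subsets of
  \<open>S \<inter> {..n}\<close>.\<close>

lemma power_le_power_card_Int_atMost:
  fixes S :: "nat set"
  assumes "\<And>n. c \<le> n \<Longrightarrow> n \<in> S"
  shows "2 ^ n \<le> (2::real) ^ c * 2 ^ card (S \<inter> {..n})"
proof -
  have "card {c..n} \<le> card (S \<inter> {..n})" using assms by (intro card_mono) auto
  then have "n \<le> c + card (S \<inter> {..n})" by simp
  then show ?thesis by (simp flip: power_add)
qed

lemma two_le_card:
  assumes "finite B" "x \<in> B" "B \<noteq> {x}"
  shows "2 \<le> card B"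
proof (rule ccontr)
  assume "\<not> 2 \<le> card B"
  then have "card B = 1" using assms card_gt_0_iff[of B] by fastforce
  then show False using assms by (metis card_1_singletonE singletonD)
qed

lemma divide_le_scaled:
  fixes a x k N :: real
  assumes "N \<le> k * x" "0 \<le> a" "0 < x" "0 < N"
  shows "a / x \<le> k * (a / N)"
proof -
  have "N * a \<le> k * x * a" using assms by (intro mult_right_mono)
  then show ?thesis using assms by (simp add: field_simps)
qed

section \<open>Atoms of the restricted power monoid\<close>

text \<open>A summand that contains 0 and is not \<open>{0}\<close> has at least two elements. So
  every non-atom other than \<open>{0}\<close> is decomposable, and decomposable sets are
  negligible.\<close>

lemma restricted_atom_density_tendsto:
  fixes S :: "nat set"
  assumes "0 \<in> S" and c: "\<And>n. c \<le> n \<Longrightarrow> n \<in> S"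
  shows "(\<lambda>n. atom_density (restricted_power_monoid S) (real n)) \<longlonglongrightarrow> 1"
proof (rule tendsto_sandwich[OF _ _ _ tendsto_const])
  define H where "H = restricted_power_monoid S"
  define g where "g n = real (card {A. A \<subseteq> {..n} \<and> decomposable A})" for n
  define X where "X n = {A \<in> H. Max A \<le> n}" for n
  define Y where "Y n = {A \<in> atoms H. Max A \<le> n}" for n
  have YX: "Y n \<subseteq> X n" for n by (auto simp: X_def Y_def atoms_def)
  have finX: "finite (X n)" for n
    unfolding X_def H_def restricted_power_monoid_Max_le[OF assms(1)] by (rule finite_subset[of _ "Pow {..n}"]) auto
  have cX: "card (X n) = 2 ^ (card (S \<inter> {..n}) - 1)" for n
    unfolding X_def H_def restricted_power_monoid_Max_le[OF assms(1)]
    using card_Pow_between[of "S \<inter> {..n}" "{0}"] assms(1) by simp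
  have X0: "0 < card (X n)" for n by (simp add: cX)
  have eq: "atom_density (restricted_power_monoid S) (real n) = card (Y n) / card (X n)" for n
    by (simp add: atom_density_of_nat X_def Y_def H_def)
  show "\<forall>\<^sub>F n in sequentially. atom_density (restricted_power_monoid S) (real n) \<le> 1"
    unfolding eq using card_mono[OF finX YX] X0 by (auto simp: divide_le_eq_1)
  show "\<forall>\<^sub>F n in sequentially. 1 - 2 ^ (c + 1) * (1 / 2 ^ n + g n / 2 ^ n)
      \<le> atom_density (restricted_power_monoid S) (real n)"
  proof (rule always_eventually, rule allI)
    fix n
    have "X n - Y n \<subseteq> insert {0} {A. A \<subseteq> {..n} \<and> decomposable A}"
    proof
      fix A assume A: "A \<in> X n - Y n"
      have An: "A \<subseteq> {..n}"
        using A restricted_power_monoid_Max_le[OF assms(1), of n] by (auto simp: X_def H_def)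
      show "A \<in> insert {0} {A. A \<subseteq> {..n} \<and> decomposable A}"
      proof (cases "A = {0}")
        case False
        then obtain B C where BC: "B \<in> H" "C \<in> H" "A = B + C" "B \<noteq> {0}" "C \<noteq> {0}"
          using A by (auto simp: X_def Y_def atoms_def)
        then have "2 \<le> card B" "2 \<le> card C"
          by (auto intro!: two_le_card simp: H_def restricted_power_monoid_def power_monoid_def)
        then show ?thesis using An BC(3) by (auto simp: decomposable_def)
      qed simp
    qed
    then have "card (X n - Y n) \<le> card (insert {0} {A. A \<subseteq> {..n} \<and> decomposable A})"
      by (intro card_mono) auto
    also have "\<dots> \<le> 1 + card {A. A \<subseteq> {..n} \<and> decomposable A}"
      using card_insert_le_m1 card_insert_if[of "{A. A \<subseteq> {..n} \<and> decomposable A}" "{0}"] by auto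
    finally have "real (card (X n)) - card (Y n) \<le> 1 + g n"
      using card_Diff_subset[OF finite_subset[OF YX finX] YX, of n] card_mono[OF finX YX, of n]
      by (simp add: g_def)
    from divide_right_mono[OF this, of "real (card (X n))"]
    have "1 - card (Y n) / card (X n) \<le> (1 + g n) / card (X n)"
      using X0[of n] by (simp add: diff_divide_distrib)
    also have "\<dots> \<le> 2 ^ (c + 1) * ((1 + g n) / 2 ^ n)"
    proof -
      have "0 < card (S \<inter> {..n})"
        using assms(1) by (subst card_gt_0_iff) auto
      \<comment> \<open>Requiring \<open>0 \<in> A\<close> halves the number of sets, whence
        \<open>c + 1\<close> in place of \<open>c\<close>.\<close>
      then have "2 ^ c * 2 ^ card (S \<inter> {..n}) = (2::real) ^ (c + 1) * card (X n)"
        by (cases "card (S \<inter> {..n})") (simp_all add: cX)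
      then have "2 ^ n \<le> (2::real) ^ (c + 1) * card (X n)"
        using power_le_power_card_Int_atMost[of c S n] c by simp
      then show ?thesis using X0[of n] by (intro divide_le_scaled) (auto simp: g_def)
    qed
    finally show "1 - 2 ^ (c + 1) * (1 / 2 ^ n + g n / 2 ^ n)
      \<le> atom_density (restricted_power_monoid S) (real n)"
      unfolding eq by (simp add: add_divide_distrib)
  qed
  have "(\<lambda>n. 1 - 2 ^ (c + 1) * (1 / 2 ^ n + g n / 2 ^ n)) \<longlonglongrightarrow> 1 - 2 ^ (c + 1) * (0 + 0)"
    unfolding g_def
    by (intro tendsto_intros card_decomposable_negligible LIMSEQ_divide_realpow_zero) simp
  then show "(\<lambda>n. 1 - 2 ^ (c + 1) * (1 / 2 ^ n + g n / 2 ^ n)) \<longlonglongrightarrow> 1" by simp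
qed

section \<open>Atoms of the full power monoid\<close>

text \<open>Says that \<open>A = {s} + C\<close> for some positive \<open>s \<in> S\<close> and some
  \<open>C \<subseteq> S\<close>: a singleton other than \<open>{0}\<close> splits off. The empty
  set qualifies as soon as \<open>S\<close> has a positive element.\<close>

definition translated :: "nat set \<Rightarrow> nat set \<Rightarrow> bool" where
  "translated S A \<longleftrightarrow> (\<exists>s\<in>S. 0 < s \<and> A \<subseteq> (+) s ` S)"

text \<open>If the initial part lies in \<open>s + S\<close> with \<open>s \<le> 2 * c\<close>, then
  \<open>s + S\<close> also contains everything beyond \<open>3 * c\<close>. If
  \<open>s > 2 * c\<close>, then all of \<open>A\<close> lies above \<open>2 * c\<close>, hence in
  \<open>c + S\<close>, and \<open>c\<close> replaces \<open>s\<close>.\<close>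

lemma translated_iff_initial:
  assumes c: "0 < c" "\<And>n. c \<le> n \<Longrightarrow> n \<in> S"
  shows "translated S A \<longleftrightarrow> translated S (A \<inter> {..3 * c})"
proof
  assume "translated S (A \<inter> {..3 * c})"
  then obtain s where s: "s \<in> S" "0 < s" "A \<inter> {..3 * c} \<subseteq> (+) s ` S" by (auto simp: translated_def)
  have large: "n \<in> (+) u ` S" if "u + c \<le> n" for u n
    using that c(2)[of "n - u"] by (intro image_eqI[of _ _ "n - u"]) auto
  show "translated S A"
  proof (cases "s \<le> 2 * c")
    case True
    have "A \<subseteq> (+) s ` S"
    proof
      fix a assume "a \<in> A"
      then show "a \<in> (+) s ` S"
        using s(3) large[of s a] True by (cases "a \<le> 3 * c") auto
    qed
    then show ?thesis using s by (auto simp: translated_def)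
  next
    case False
    have "A \<subseteq> (+) c ` S"
    proof
      fix a assume "a \<in> A"
      have "2 * c \<le> a"
      proof (cases "a \<le> 3 * c")
        case True
        then have "a \<in> (+) s ` S" using \<open>a \<in> A\<close> s(3) by blast
        then show ?thesis using False by auto
      qed simp
      then show "a \<in> (+) c ` S" by (intro large) simp
    qed
    then show ?thesis using c by (auto simp: translated_def)
  qed
qed (auto simp: translated_def)

text \<open>The part of \<open>A\<close> above \<open>3 * c\<close> is a free subset of
  \<open>R \<subseteq> S\<close>, so the proportion of translated sets is the same for every
  \<open>n \<ge> 3 * c\<close>; the equation is this statement cross-multiplied.\<close>

lemma card_translated:
  assumes c: "0 < c" "\<And>n. c \<le> n \<Longrightarrow> n \<in> S" and n: "3 * c \<le> n"
  shows "card {A. A \<subseteq> S \<inter> {..n} \<and> translated S A} * 2 ^ card (S \<inter> {..3 * c})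
    = card {A. A \<subseteq> S \<inter> {..3 * c} \<and> translated S A} * 2 ^ card (S \<inter> {..n})"
proof -
  define R where "R = {3 * c<..n}"
  define X where "X m = {A. A \<subseteq> S \<inter> {..m} \<and> translated S A}" for m
  have RS: "R \<subseteq> S" using c(2) by (auto simp: R_def)
  have "bij_betw (\<lambda>A. (A \<inter> {..3 * c}, A \<inter> R)) (X n) (X (3 * c) \<times> Pow R)"
  proof (rule bij_betw_byWitness[where f' = "\<lambda>(A, B). A \<union> B"])
    show "\<forall>A\<in>X n. (case (A \<inter> {..3 * c}, A \<inter> R) of (A, B) \<Rightarrow> A \<union> B) = A"
      by (auto simp: X_def R_def)
    show "\<forall>p\<in>X (3 * c) \<times> Pow R. ((case p of (A, B) \<Rightarrow> A \<union> B) \<inter> {..3 * c},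
        (case p of (A, B) \<Rightarrow> A \<union> B) \<inter> R) = p"
      by (fastforce simp: X_def R_def)
    show "(\<lambda>A. (A \<inter> {..3 * c}, A \<inter> R)) ` X n \<subseteq> X (3 * c) \<times> Pow R"
      using translated_iff_initial[OF c] by (auto simp: X_def)
    show "(\<lambda>(A, B). A \<union> B) ` (X (3 * c) \<times> Pow R) \<subseteq> X n"
    proof clarify
      fix A B assume AB: "A \<in> X (3 * c)" "B \<subseteq> R"
      then have "(A \<union> B) \<inter> {..3 * c} = A" by (auto simp: X_def R_def)
      then have "translated S (A \<union> B)"
        using AB(1) translated_iff_initial[OF c, of "A \<union> B"] by (auto simp: X_def)
      then show "A \<union> B \<in> X n" using AB RS n by (auto simp: X_def R_def)
    qed
  qed
  then have "card (X n) = card (X (3 * c)) * 2 ^ card R"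
    by (simp add: bij_betw_same_card card_cartesian_product card_Pow R_def)
  moreover have "card (S \<inter> {..n}) = card (S \<inter> {..3 * c}) + card R"
  proof -
    have "S \<inter> {..n} = (S \<inter> {..3 * c}) \<union> R" using RS n by (auto simp: R_def)
    then show ?thesis by (simp add: card_Un_disjoint R_def disjoint_iff)
  qed
  ultimately show ?thesis unfolding X_def[symmetric] by (simp add: power_add)
qed

text \<open>Up to few exceptions the atoms are the complement of the translated sets: a translated
  atom must be a singleton, and a nonempty set that is neither an atom nor translated is
  \<open>{0}\<close> or decomposable.\<close>

lemma card_atoms_power_monoid_bounds:
  fixes S :: "nat set"
  assumes S0: "0 \<in> S" and ex: "\<exists>s\<in>S. 0 < s"
  defines "T n \<equiv> {A. A \<subseteq> S \<inter> {..n} \<and> translated S A}"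
  defines "Y n \<equiv> {A \<in> atoms (power_monoid S). Max A \<le> n}"
  shows "card (Y n) + card (T n) \<le> 2 ^ card (S \<inter> {..n}) + (n + 1)"
    and "2 ^ card (S \<inter> {..n}) \<le> card (Y n) + card (T n) + 1 + card {A. A \<subseteq> {..n} \<and> decomposable A}"
proof -
  define H where "H = power_monoid S"
  have H: "finite A" "A \<noteq> {}" "A \<subseteq> S" if "A \<in> H" for A
    using that by (auto simp: H_def power_monoid_def)
  have Heq: "A \<in> H \<and> Max A \<le> n \<longleftrightarrow> A \<subseteq> S \<inter> {..n} \<and> A \<noteq> {}" for A
    using arg_cong[OF power_monoid_Max_le[of S n], of "\<lambda>X. A \<in> X"]
    by (simp only: mem_Collect_eq Diff_iff Pow_iff singleton_iff H_def)
  have atomsH: "A \<in> H" if "A \<in> atoms H" for A using that by (simp add: atoms_def)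
  have Yeq: "A \<in> Y n \<longleftrightarrow> A \<in> atoms H \<and> A \<subseteq> S \<inter> {..n} \<and> A \<noteq> {}" for A
    unfolding Y_def mem_Collect_eq H_def[symmetric] using Heq atomsH by blast
  have finY: "finite (Y n)" by (rule finite_subset[of _ "Pow {..n}"]) (auto simp: Yeq)
  have finT: "finite (T n)" by (rule finite_subset[of _ "Pow {..n}"]) (auto simp: T_def)
  have "Y n \<inter> T n \<subseteq> (\<lambda>s. {s}) ` {..n}"
  proof
    fix A assume A: "A \<in> Y n \<inter> T n"
    then obtain s where s: "s \<in> S" "0 < s" "A \<subseteq> (+) s ` S" by (auto simp: T_def translated_def)
    define C where "C = (\<lambda>a. a - s) ` A"
    have AC: "A = {s} + C"
    proof -
      have "s + (a - s) = a" if "a \<in> A" for a using s(3) that by auto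
      then have "(\<lambda>x. s + (x - s)) ` A = A" by simp
      moreover have "{s} + C = (\<lambda>x. s + (x - s)) ` A" by (auto simp: C_def set_plus_def)
      ultimately show ?thesis by simp
    qed
    have "A \<in> H" using A by (auto simp: Yeq atoms_def)
    then have "C \<in> H" using s(3) by (auto simp: C_def H_def power_monoid_def)
    moreover have "{s} \<in> H" using s by (simp add: H_def power_monoid_def)
    moreover have "A \<in> atoms H" using A by (simp add: Yeq)
    ultimately have "C = {0}" using AC s(2) by (auto simp: atoms_def)
    then have "A = {s}" using AC by (auto simp: set_plus_def)
    then show "A \<in> (\<lambda>s. {s}) ` {..n}" using A by (auto simp: Yeq)
  qed
  then have "card (Y n \<inter> T n) \<le> card ((\<lambda>s. {s}) ` {..n})" by (rule card_mono[rotated]) simp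
  also have "\<dots> \<le> n + 1" using card_image_le[of "{..n}" "\<lambda>s. {s}"] by simp
  finally have "card (Y n \<inter> T n) \<le> n + 1" .
  moreover have "card (Y n \<union> T n) \<le> card (Pow (S \<inter> {..n}))"
    by (rule card_mono) (auto simp: Yeq T_def)
  moreover have "card (Y n) + card (T n) = card (Y n \<union> T n) + card (Y n \<inter> T n)"
    by (rule card_Un_Int[OF finY finT])
  ultimately show "card (Y n) + card (T n) \<le> 2 ^ card (S \<inter> {..n}) + (n + 1)"
    by (simp add: card_Pow del: Pow_Int_eq)

  have "Pow (S \<inter> {..n}) \<subseteq> Y n \<union> T n \<union> {{0}} \<union> {A. A \<subseteq> {..n} \<and> decomposable A}"
  proof
    fix A assume A: "A \<in> Pow (S \<inter> {..n})"
    show "A \<in> Y n \<union> T n \<union> {{0}} \<union> {A. A \<subseteq> {..n} \<and> decomposable A}"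
    proof (rule ccontr)
      assume not: "\<not> ?thesis"
      \<comment> \<open>The empty set counts as translated, so it already belongs to
        \<open>T n\<close>.\<close>
      have ne: "A \<noteq> {}" using not ex by (auto simp: T_def translated_def)
      have "finite A" using A by (auto intro: finite_subset)
      then have "A \<in> H" using A ne by (auto simp: H_def power_monoid_def)
      then obtain B C where BC: "B \<in> H" "C \<in> H" "A = B + C" "B \<noteq> {0}" "C \<noteq> {0}"
        using not A ne by (auto simp: Yeq atoms_def)
      \<comment> \<open>A nonempty summand with fewer than two elements is some \<open>{s}\<close>,
        and \<open>s\<close> is positive because the summand is not \<open>{0}\<close>.\<close>
      have single: "translated S (D + E)"
        if DE: "D \<in> H" "D \<noteq> {0}" "\<not> 2 \<le> card D" "E \<in> H" for D E
      proof -
        obtain s where "s \<in> D" using H(2)[OF DE(1)] by blast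
        then have D: "D = {s}" using two_le_card[of D s] H(1)[OF DE(1)] DE(3) by blast
        then have "s \<in> S" "0 < s" using H(3)[OF DE(1)] DE(2) by auto
        moreover have "D + E \<subseteq> (+) s ` S" using H(3)[OF DE(4)] by (auto simp: D set_plus_def)
        ultimately show ?thesis by (auto simp: translated_def)
      qed
      have "\<not> translated S A" using not A by (auto simp: T_def)
      then have "2 \<le> card B" "2 \<le> card C"
        using single[of B C] single[of C B] BC by (auto simp: add.commute)
      then show False using not A BC by (auto simp: decomposable_def)
    qed
  qed
  then have "card (Pow (S \<inter> {..n}))
      \<le> card (Y n \<union> T n \<union> {{0}} \<union> {A. A \<subseteq> {..n} \<and> decomposable A})"
    by (rule card_mono[rotated]) (use finY finT in auto)
  also have "\<dots> \<le> card (Y n \<union> T n \<union> {{0}}) + card {A. A \<subseteq> {..n} \<and> decomposable A}"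
    by (rule card_Un_le)
  also have "\<dots> \<le> card (Y n \<union> T n) + card {{0::nat}} + card {A. A \<subseteq> {..n} \<and> decomposable A}"
    by (intro add_right_mono card_Un_le)
  also have "\<dots> \<le> card (Y n) + card (T n) + card {{0::nat}} + card {A. A \<subseteq> {..n} \<and> decomposable A}"
    by (intro add_right_mono card_Un_le)
  finally show "2 ^ card (S \<inter> {..n}) \<le> card (Y n) + card (T n) + 1 + card {A. A \<subseteq> {..n} \<and> decomposable A}"
    by (simp add: card_Pow del: Pow_Int_eq)
qed

text \<open>For \<open>n \<ge> 3 * c\<close> the translated sets have proportion exactly
  \<open>\<beta>\<close>, so the atoms number \<open>(1 - \<beta>) * P n\<close> up to an error of
  at most \<open>g n + n + 1\<close>, which is negligible.\<close>

lemma atom_density_power_monoid_tendsto: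
  assumes S0: "0 \<in> S" and c: "0 < c" "\<And>n. c \<le> n \<Longrightarrow> n \<in> S"
  defines "\<beta> \<equiv> real (card {A. A \<subseteq> S \<inter> {..3 * c} \<and> translated S A}) / 2 ^ card (S \<inter> {..3 * c})"
  shows "(\<lambda>n. atom_density (power_monoid S) (real n)) \<longlonglongrightarrow> 1 - \<beta>"
proof -
  define g where "g n = real (card {A. A \<subseteq> {..n} \<and> decomposable A})" for n
  define Y where "Y n = {A \<in> atoms (power_monoid S). Max A \<le> n}" for n
  define T where "T n = {A. A \<subseteq> S \<inter> {..n} \<and> translated S A}" for n
  define P where "P n = (2::real) ^ card (S \<inter> {..n})" for n
  have \<beta>_eq: "\<beta> = real (card (T (3 * c))) / 2 ^ card (S \<inter> {..3 * c})"
    unfolding \<beta>_def T_def ..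
  have ex: "\<exists>s\<in>S. 0 < s" using c by blast
  have P2: "2 \<le> P n" for n
  proof -
    have "0 < card (S \<inter> {..n})" using S0 by (subst card_gt_0_iff) auto
    then show ?thesis unfolding P_def using power_increasing[of 1 "card (S \<inter> {..n})" "2::real"] by simp
  qed
  \<comment> \<open>The subtracted 1 accounts for the empty set, which is not in the monoid.\<close>
  have dens: "atom_density (power_monoid S) (real n) = card (Y n) / (P n - 1)" for n
  proof -
    have "real (card (Pow (S \<inter> {..n}) - {{}})) = P n - 1"
      by (simp add: card_Diff_singleton card_Pow P_def of_nat_diff del: Pow_Int_eq)
    then show ?thesis by (simp add: atom_density_of_nat power_monoid_Max_le Y_def)
  qed
  have cT: "real (card (T n)) = \<beta> * P n" if "3 * c \<le> n" for n
  proof -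
    have "real (card (T n) * 2 ^ card (S \<inter> {..3 * c})) = real (card (T (3 * c)) * 2 ^ card (S \<inter> {..n}))"
      unfolding T_def using card_translated[OF c that] by (simp only:)
    then show ?thesis by (simp add: \<beta>_eq P_def field_simps)
  qed
  have \<beta>: "0 \<le> \<beta>" "\<beta> \<le> 1"
  proof -
    have "card (T (3 * c)) \<le> card (Pow (S \<inter> {..3 * c}))" by (rule card_mono) (auto simp: T_def)
    then have "card (T (3 * c)) \<le> 2 ^ card (S \<inter> {..3 * c})"
      by (simp add: card_Pow del: Pow_Int_eq)
    then have "real (card (T (3 * c))) \<le> real (2 ^ card (S \<inter> {..3 * c}))"
      by (simp only: of_nat_le_iff)
    then show "0 \<le> \<beta>" "\<beta> \<le> 1" by (simp_all add: \<beta>_eq)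
  qed
  have ev: "\<forall>\<^sub>F n in sequentially. norm (atom_density (power_monoid S) (real n) - (1 - \<beta>))
      \<le> 2 ^ (c + 1) * (g n / 2 ^ n + (real n + 3) / 2 ^ n)"
  proof (rule eventually_sequentiallyI[of "3 * c"])
    fix n assume n: "3 * c \<le> n"
    have P1: "0 < P n - 1" using P2[of n] by simp
    have "real (card (Y n) + card (T n)) \<le> real (2 ^ card (S \<inter> {..n}) + (n + 1))"
      and "real (2 ^ card (S \<inter> {..n})) \<le> real (card (Y n) + card (T n) + 1 + card {A. A \<subseteq> {..n} \<and> decomposable A})"
      using card_atoms_power_monoid_bounds[OF S0 ex, of n] by (simp_all only: Y_def T_def of_nat_le_iff)
    then have b: "card (Y n) + \<beta> * P n \<le> P n + n + 1" "P n \<le> card (Y n) + \<beta> * P n + 1 + g n"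
      using cT[OF n] by (simp_all add: P_def g_def)
    have g0: "0 \<le> g n" by (simp add: g_def)
    \<comment> \<open>Passing from \<open>P n\<close> to \<open>P n - 1\<close> shifts the main term
      by \<open>1 - \<beta>\<close>, at most 1.\<close>
    have "\<bar>card (Y n) - (1 - \<beta>) * (P n - 1)\<bar> \<le> g n + (real n + 3)"
      using b \<beta> g0 by (simp add: abs_le_iff algebra_simps)
    then have "\<bar>card (Y n) - (1 - \<beta>) * (P n - 1)\<bar> / (P n - 1) \<le> (g n + (real n + 3)) / (P n - 1)"
      using P1 by (intro divide_right_mono) auto
    moreover have "\<bar>card (Y n) - (1 - \<beta>) * (P n - 1)\<bar> / (P n - 1) = \<bar>card (Y n) / (P n - 1) - (1 - \<beta>)\<bar>"
    proof -
      have "card (Y n) / (P n - 1) - (1 - \<beta>) = (card (Y n) - (1 - \<beta>) * (P n - 1)) / (P n - 1)"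
        using P1 by (simp add: diff_divide_distrib)
      then show ?thesis using P1 by (simp add: abs_divide)
    qed
    moreover have "(g n + (real n + 3)) / (P n - 1) \<le> 2 ^ (c + 1) * ((g n + (real n + 3)) / 2 ^ n)"
    proof (rule divide_le_scaled)
      have "2 ^ n \<le> 2 ^ c * P n"
        unfolding P_def using power_le_power_card_Int_atMost[of c S n] c by simp
      \<comment> \<open>\<open>P n - 1\<close> is at least half of \<open>P n\<close>, since
        \<open>P n\<close> is at least 2.\<close>
      also have "\<dots> \<le> 2 ^ c * (2 * (P n - 1))" using P2[of n] by (intro mult_left_mono) auto
      finally show "2 ^ n \<le> 2 ^ (c + 1) * (P n - 1)" by (simp add: algebra_simps)
    qed (use g0 P1 in auto)
    ultimately show "norm (atom_density (power_monoid S) (real n) - (1 - \<beta>))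
      \<le> 2 ^ (c + 1) * (g n / 2 ^ n + (real n + 3) / 2 ^ n)"
      unfolding dens by (simp add: add_divide_distrib)
  qed
  have lim: "(\<lambda>n. 2 ^ (c + 1) * (g n / 2 ^ n + (real n + 3) / 2 ^ n)) \<longlonglongrightarrow> 0"
  proof -
    have "(\<lambda>n. (real n + 3) / 2 ^ n) \<longlonglongrightarrow> 0" by real_asymp
    then have "(\<lambda>n. 2 ^ (c + 1) * (g n / 2 ^ n + (real n + 3) / 2 ^ n)) \<longlonglongrightarrow> 2 ^ (c + 1) * (0 + 0)"
      unfolding g_def by (intro tendsto_intros card_decomposable_negligible)
    then show ?thesis by simp
  qed
  have "(\<lambda>n. norm (atom_density (power_monoid S) (real n) - (1 - \<beta>))) \<longlonglongrightarrow> 0"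
    by (rule tendsto_sandwich[OF _ ev tendsto_const lim]) simp
  then show ?thesis by (rule LIM_zero_cancel[OF tendsto_norm_zero_cancel])
qed

text \<open>Translated sets omit 0, so they are among the subsets of \<open>V\<close>, which make up
  exactly half of all. Equality forces \<open>V\<close> itself to be translated by some
  \<open>s\<close>, and descending in steps of \<open>s\<close> from the numbers above
  \<open>c\<close> then puts every natural into \<open>S\<close>.\<close>

lemma card_translated_le_half:
  assumes S0: "0 \<in> S" and c: "0 < c" "\<And>n. c \<le> n \<Longrightarrow> n \<in> S"
  defines "T \<equiv> {A. A \<subseteq> S \<inter> {..3 * c} \<and> translated S A}"
  shows "0 < card T" "2 * card T \<le> 2 ^ card (S \<inter> {..3 * c})"
    and "2 * card T = 2 ^ card (S \<inter> {..3 * c}) \<longleftrightarrow> S = UNIV"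
proof -
  define V where "V = S \<inter> {..3 * c} - {0}"
  have finV: "finite V" by (simp add: V_def)
  have TV: "T \<subseteq> Pow V" by (auto simp: T_def V_def translated_def)
  have cV: "2 * card (Pow V) = 2 ^ card (S \<inter> {..3 * c})"
  proof -
    have "card (S \<inter> {..3 * c}) = Suc (card V)"
      using card_Suc_Diff1[of "S \<inter> {..3 * c}" 0] S0 by (simp add: V_def)
    then show ?thesis using finV by (simp add: card_Pow)
  qed
  have "{} \<in> T" using c by (auto simp: T_def translated_def)
  then show "0 < card T" using finite_subset[OF TV] finV card_gt_0_iff by auto
  show "2 * card T \<le> 2 ^ card (S \<inter> {..3 * c})"
    unfolding cV[symmetric] using card_mono[OF _ TV] finV by simp
  show "2 * card T = 2 ^ card (S \<inter> {..3 * c}) \<longleftrightarrow> S = UNIV"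
  proof
    assume "2 * card T = 2 ^ card (S \<inter> {..3 * c})"
    then have "card T = card (Pow V)" unfolding cV[symmetric] by simp
    then have "T = Pow V" using TV finV by (intro card_subset_eq) auto
    then have "V \<in> T" by simp
    then obtain s where s: "s \<in> S" "0 < s" "V \<subseteq> (+) s ` S" by (auto simp: T_def translated_def)
    have pred: "x \<in> S" if "s + x \<in> V" for x using s(3) that by auto
    have "s \<le> c"
    proof -
      have "c \<in> V" using c by (auto simp: V_def)
      then show ?thesis using s(3) by auto
    qed
    have "x \<in> S" for x
    \<comment> \<open>For \<open>x < c\<close> the larger number \<open>s + x\<close> is in
      \<open>S\<close> by induction; it is positive and below \<open>2 * c\<close>, hence in
      \<open>V\<close>, so \<open>pred\<close> gives \<open>x\<close>.\<close>
    proof (induction "c - x" arbitrary: x rule: less_induct)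
      case less
      show ?case
      proof (cases "c \<le> x")
        case False
        then have "s + x \<in> S" using s(2) by (intro less) simp
        then have "s + x \<in> V" using s(2) \<open>s \<le> c\<close> False by (simp add: V_def)
        then show ?thesis by (rule pred)
      qed (rule c(2))
    qed
    then show "S = UNIV" by auto
  next
    assume U: "S = UNIV"
    have "Pow V \<subseteq> T"
    proof
      fix A assume "A \<in> Pow V"
      then have A: "A \<subseteq> S \<inter> {..3 * c}" "0 \<notin> A" by (auto simp: V_def)
      have "A \<subseteq> (+) 1 ` S"
      proof
        fix a assume "a \<in> A"
        then show "a \<in> (+) 1 ` S" using A(2) U by (cases a) auto
      qed
      then have "translated S A" unfolding translated_def using U zero_less_one by blast
      then show "A \<in> T" using A by (simp add: T_def)
    qed
    then show "2 * card T = 2 ^ card (S \<inter> {..3 * c})" unfolding cV[symmetric] using TV by auto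
  qed
qed

theorem theorem6p1:
  fixes S :: "nat set"
  assumes "numerical_monoid S"
  shows "(atom_density (restricted_power_monoid S) \<longlongrightarrow> 1) at_top
    \<and> (\<exists>L. (atom_density (power_monoid S) \<longlongrightarrow> L) at_top
          \<and> L \<in> {1/2..<1} \<inter> \<rat>
          \<and> (L = 1/2 \<longleftrightarrow> S = UNIV))"
proof -
  have S: "0 \<in> S"
    using assms by (auto simp: numerical_monoid_def additive_submonoid_def)
  obtain c where c: "0 < c" "\<And>n. c \<le> n \<Longrightarrow> n \<in> S"
    using numerical_monoid_conductor[OF assms] by blast
  define N where "N = card (S \<inter> {..3 * c})"
  define K where "K = card {A. A \<subseteq> S \<inter> {..3 * c} \<and> translated S A}"
  \<comment> \<open>A quotient of naturals makes the limit rational. It is below 1 because the empty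
    set contributes to \<open>K\<close>, and at least 1/2 because
    \<open>2 * K \<le> 2 ^ N\<close>.\<close>
  define L where "L = 1 - real K / 2 ^ N"
  note K = card_translated_le_half[OF S c, folded K_def N_def]
  have "real (2 * K) \<le> real (2 ^ N)" using K(2) by (simp only: of_nat_le_iff)
  then have "1 / 2 \<le> L" by (simp add: L_def field_simps)
  moreover have "L < 1" using K(1) by (simp add: L_def)
  moreover have "L \<in> \<rat>" by (simp add: L_def)
  moreover have "L = 1 / 2 \<longleftrightarrow> S = UNIV"
  proof -
    have "L = 1 / 2 \<longleftrightarrow> real (2 * K) = real (2 ^ N)" by (auto simp: L_def field_simps)
    then show ?thesis using K(3) by (simp only: of_nat_eq_iff)
  qed
  moreover have "(atom_density (power_monoid S) \<longlongrightarrow> L) at_top"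
    unfolding L_def K_def N_def
    by (intro tendsto_atom_densityI atom_density_power_monoid_tendsto S c)
  moreover have "(atom_density (restricted_power_monoid S) \<longlongrightarrow> 1) at_top"
    by (intro tendsto_atom_densityI restricted_atom_density_tendsto[of S c] S c(2))
  ultimately show ?thesis by auto
qed

end
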